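(* Let $J,K\ge 1$ be integers, $A=\{1,\dots,J\}$, $B=\{1,\dots,K\}$, and fix $\rho_{\max}>0$. For any $d>0$, there exists a universal distortion $d$-semifaithful code $\tilde C_n$ (one for each block length $n$) satisfying $$\limsup_{n\to\infty}\ \sup_{(p,\rho)\in\mathcal P(A)\times\mathcal D^{\rho_{\max}}}\ \frac{\overline{\mathcal R}_n(\tilde C_n,p,\rho)}{\ln n/n}\ \le\ JK+J.$$
   Context: $\mathcal P(A)$ is the set of probability distributions on $A$; for $p\in\mathcal P(A)$, $p^n$ is the $n$-fold product distribution on $A^n$. $\mathcal D$ is the set of all distortion measures $\rho:A\times B\to[0,\infty)$ satisfying the standing assumption $\max_{j\in A}\min_{k\in B}\rho(j,k)=0$, and $\mathcal D^{\rho_{\max}}\subset\mathcal D$ is the subset of those with $\rho(j,k)\le\rho_{\max}$ for all $j,k$. The $n$-fold extension is $\rho_n(x^n,y^n)=\frac1n\sum_{i=1}^n\rho(x_i,y_i)$. Entropy $H$ is in nats. Universal distortion $d$-semifaithful code (order $n$): a triple $\tilde C_n=(\phi_n,f_n,g_n)$ with $\phi_n:A^n\times\mathcal D\to B_{\phi_n}$, $f_n:B_{\phi_n}\to\mathcal B^*$, $g_n:\mathcal B^*\to B_{\phi_n}$, where $B_{\phi_n}\subset B^n$ is the codebook, $\mathcal B^*$ is a set of binary strings, $(f_n,g_n)$ is a prefix-free (lossless) binary encoder/decoder pair (the strings $f_n(y^n)$ form a prefix-free set and $g_n(f_n(y^n))=y^n$ for all $y^n\in B_{\phi_n}$), and $\phi_n$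 is a $d$-quantizer with respect to the input distortion measure: $\rho_n(x^n,\phi_n(x^n,\rho))\le d$ for all $x^n\in A^n$ and all input $\rho$. $l(b)$ denotes the length of a binary string $b$. For $\rho\in\mathcal D$, $\mathcal Q_{d,\rho}$ is the set of all maps $\phi:A^n\to B^n$ with $\rho_n(x^n,\phi(x^n))\le d$ for all $x^n\in A^n$. For such $\phi$, $\nu_{p^n,\phi}$ is the distribution of $\phi(X^n)$ when $X^n\sim p^n$. Operational rate redundancy: with $X^n\sim p^n$, $$\overline{\mathcal R}_n(\tilde C_n,p,\rho)=\frac1n\mathbb E\big[l(f_n(\phi_n(X^n,\rho)))\ln 2\big]-\inf_{\phi\in\mathcal Q_{d,\rho}}\frac{H(\nu_{p^n,\phi})}{n}.$$ *)

theory Defs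
  imports "HOL-Probability.Probability" "HOL-Library.Sublist"
begin

text \<open>
  The source alphabet is a finite type \<open>'a\<close> and the reproduction alphabet a finite type \<open>'b\<close>, so
  that the alphabet sizes are \<open>CARD('a)\<close> and \<open>CARD('b)\<close>. Blocks of length \<open>n\<close> are lists of
  length \<open>n\<close>, and the \<open>n\<close>-fold product of \<open>p :: 'a pmf\<close> is \<open>replicate_pmf n p\<close>.
\<close>

definition blocks :: "nat \<Rightarrow> 'c list set" where
  "blocks n = {xs. length xs = n}"

definition distortion_measures :: "('a::finite \<Rightarrow> 'b::finite \<Rightarrow> real) set" where
  "distortion_measures = {\<rho>. (\<forall>j k. 0 \<le> \<rho> j k) \<and> (MAX j. MIN k. \<rho> j k) = 0}"

definition bounded_distortion_measures :: "real \<Rightarrow> ('a::finite \<Rightarrow> 'b::finite \<Rightarrow> real) set" where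
  "bounded_distortion_measures \<rho>max = {\<rho> \<in> distortion_measures. \<forall>j k. \<rho> j k \<le> \<rho>max}"

definition block_distortion :: "nat \<Rightarrow> ('a \<Rightarrow> 'b \<Rightarrow> real) \<Rightarrow> 'a list \<Rightarrow> 'b list \<Rightarrow> real" where
  "block_distortion n \<rho> xs ys = (1 / real n) * (\<Sum>i<n. \<rho> (xs ! i) (ys ! i))"

text \<open>
  A quantizer is a total function on lists of which only the values on \<open>blocks n\<close> matter; its
  values elsewhere are unconstrained.
\<close>

definition d_quantizers :: "nat \<Rightarrow> real \<Rightarrow> ('a \<Rightarrow> 'b \<Rightarrow> real) \<Rightarrow> ('a list \<Rightarrow> 'b list) set" where
  "d_quantizers n d \<rho> =
     {\<phi>. \<forall>xs \<in> blocks n. \<phi> xs \<in> blocks n \<and> block_distortion n \<rho> xs (\<phi> xs) \<le> d}"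

text \<open>
  The entropy in nats of a distribution \<open>\<nu>\<close> on a countable type, that is, the library's entropy to
  base \<open>exp 1\<close> of the identity random variable on \<open>\<nu>\<close>.
\<close>

definition entropy_pmf :: "'c::countable pmf \<Rightarrow> real" where
  "entropy_pmf \<nu> = prob_space.entropy (measure_pmf \<nu>) (exp 1) (count_space UNIV) (\<lambda>x. x)"

lemma entropy_pmf_eq_sum:
  fixes \<nu> :: "'c::countable pmf"
  assumes fin: "finite (set_pmf \<nu>)"
  shows "entropy_pmf \<nu> = - (\<Sum>x\<in>set_pmf \<nu>. pmf \<nu> x * ln (pmf \<nu> x))"
proof -
  interpret sigma_finite_measure "count_space (UNIV :: 'c set)"
    by (rule sigma_finite_measure_count_space_countable) simp
  interpret information_space "measure_pmf \<nu>" "exp 1"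
    by unfold_locales (auto simp: measure_pmf.emeasure_space_1)
  have "distributed (measure_pmf \<nu>) (count_space UNIV) (\<lambda>x. x) (\<lambda>x. ennreal (pmf \<nu> x))"
    by (auto simp: distributed_def measure_pmf_eq_density[symmetric] distr_id2)
  then have "entropy_pmf \<nu> = - (\<integral>x. pmf \<nu> x * log (exp 1) (pmf \<nu> x) \<partial>count_space UNIV)"
    unfolding entropy_pmf_def by (rule entropy_distr) simp
  also have "\<dots> = - (\<Sum>x\<in>set_pmf \<nu>. pmf \<nu> x * ln (pmf \<nu> x))"
    by (subst lebesgue_integral_count_space_finite_support)
       (auto simp: log_def set_pmf_iff intro!: sum.mono_neutral_left finite_subset[OF _ fin])
  finally show ?thesis .
qed

text \<open>
  Besides the maps \<open>\<phi>\<close>, \<open>f\<close>, \<open>g\<close> (\<open>quantize\<close>, \<open>encode\<close>, \<open>decode\<close>) a code records the codebook and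
  the set of binary strings between which \<open>f\<close> and \<open>g\<close> operate.
\<close>

record ('a, 'b) block_code =
  codebook :: "'b list set"
  codestrings :: "bool list set"
  quantize :: "'a list \<Rightarrow> ('a \<Rightarrow> 'b \<Rightarrow> real) \<Rightarrow> 'b list"
  encode :: "'b list \<Rightarrow> bool list"
  decode :: "bool list \<Rightarrow> 'b list"

definition prefix_free :: "bool list set \<Rightarrow> bool" where
  "prefix_free S \<longleftrightarrow> (\<forall>u\<in>S. \<forall>v\<in>S. prefix u v \<longrightarrow> u = v)"

definition universal_semifaithful_code ::
    "nat \<Rightarrow> real \<Rightarrow> ('a::finite, 'b::finite) block_code \<Rightarrow> bool" where
  "universal_semifaithful_code n d C \<longleftrightarrow>
     codebook C \<subseteq> blocks n \<and>
     (\<forall>xs \<in> blocks n. \<forall>\<rho> \<in> distortion_measures.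
        quantize C xs \<rho> \<in> codebook C \<and> block_distortion n \<rho> xs (quantize C xs \<rho>) \<le> d) \<and>
     encode C \<in> codebook C \<rightarrow> codestrings C \<and>
     decode C \<in> codestrings C \<rightarrow> codebook C \<and>
     prefix_free (encode C ` codebook C) \<and>
     (\<forall>ys \<in> codebook C. decode C (encode C ys) = ys)"

text \<open>
  The infimum is a real one; for \<open>d \<ge> 0\<close> and \<open>\<rho> \<in> distortion_measures\<close> it is over a nonempty set
  of nonnegative numbers.
\<close>

definition rate_redundancy ::
    "nat \<Rightarrow> real \<Rightarrow> ('a::finite, 'b::finite) block_code \<Rightarrow> 'a pmf \<Rightarrow> ('a \<Rightarrow> 'b \<Rightarrow> real) \<Rightarrow> real" where
  "rate_redundancy n d C p \<rho> =
     (1 / real n) * measure_pmf.expectation (replicate_pmf n p)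
        (\<lambda>xs. real (length (encode C (quantize C xs \<rho>))) * ln 2)
     - (INF \<phi> \<in> d_quantizers n d \<rho>. entropy_pmf (map_pmf \<phi> (replicate_pmf n p)) / real n)"

end

theory Submission
  imports Defs "HOL-Combinatorics.List_Permutation" "HOL-Real_Asymp.Real_Asymp"
begin

text \<open>
  Fix a source type \<open>T\<close> and let \<open>M\<close> be the largest number of members of \<open>T\<close> that a single
  reproduction block covers within distortion \<open>d\<close>. Given the type, the source block is uniform on
  \<open>T\<close>, so conditioning on the type shows that every \<open>d\<close>-quantizer has output entropy at least the
  mean of \<open>ln (|T| / M)\<close>.

  Conversely, put on the reproduction blocks the weight \<open>Q\<close> that is uniform over types and uniform
  within each type. Up to the number \<open>(n + 1) ^ ((J - 1) * (K - 1))\<close> of joint types with given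
  marginals, the blocks counted by \<open>M\<close> have a single joint type; double counting then yields around
  every source block a conditional type class (a shell) of admissible reproductions with \<open>Q\<close>-weight
  at least \<open>M / |T|\<close> divided by \<open>(n + 1) ^ (J * (K - 1))\<close>. There are only exponentially many shells,
  whatever the distortion measure, so one enumeration of the reproduction blocks meets each shell
  \<open>S\<close> within the first \<open>O(n) / Q(S)\<close> places. Encoding the least rank in the \<open>d\<close>-ball costs a factor
  \<open>O(n)\<close> for the enumeration and another one for announcing the length of the rank, so the overhead
  is \<open>(J * (K - 1) + 2) * ln n + O(1)\<close>, and \<open>J * (K - 1) + 2 \<le> J * K + J\<close>.
\<close>

section \<open>Blocks, type classes and shells\<close>

lemma finite_blocks [simp]: "finite (blocks n :: 'c::finite list set)"
  using finite_lists_length_eq[of "UNIV :: 'c set" n] by (simp add: blocks_def)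

lemma card_blocks: "card (blocks n :: 'c::finite list set) = CARD('c) ^ n"
  using card_lists_length_eq[of "UNIV :: 'c set" n] by (simp add: blocks_def)

text \<open>Types are represented by multisets, so this is the type class of
  \<open>xs\<close>.\<close>

definition perm_class :: "'c list \<Rightarrow> 'c list set" where
  "perm_class xs = {xs'. mset xs' = mset xs}"

text \<open>The conditional type class around \<open>xs\<close>: the joint type of a pair of blocks
  is the multiset of its letter pairs. The length is fixed separately because \<open>zip\<close>
  truncates.\<close>

definition shell :: "'a list \<Rightarrow> 'b list \<Rightarrow> 'b list set" where
  "shell xs ys = {ys'. length ys' = length xs \<and> mset (zip xs ys') = mset (zip xs ys)}"

lemma perm_class_subset_blocks: "xs \<in> blocks n \<Longrightarrow> perm_class xs \<subseteq> blocks n"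
  by (auto simp: perm_class_def blocks_def dest: mset_eq_length)

lemma finite_perm_class [simp]: "finite (perm_class xs)"
  unfolding perm_class_def by (rule finite_subset[of _ "{ys. set ys \<subseteq> set xs \<and> length ys = length xs}"])
    (auto dest: mset_eq_length mset_eq_setD intro: finite_lists_length_eq)

lemma perm_class_refl [simp]: "xs \<in> perm_class xs"
  by (simp add: perm_class_def)

lemma card_perm_class_pos: "card (perm_class xs) > 0"
  using perm_class_refl[of xs] finite_perm_class[of xs] unfolding card_gt_0_iff by blast

lemma perm_class_eq: "xs' \<in> perm_class xs \<Longrightarrow> perm_class xs' = perm_class xs"
  by (auto simp: perm_class_def)

section \<open>Counting types, and joint types with given marginals\<close>

text \<open>The counts of all letters but one determine a type, since they add up to
  \<open>n\<close>; this saves one in the exponent.\<close>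

lemma card_types_le:
  "card (mset ` (blocks n :: 'c::finite list set)) \<le> (n + 1) ^ (CARD('c) - 1)"
proof -
  obtain k0 :: 'c where True by simp
  define \<Phi> where "\<Phi> = (\<lambda>t :: 'c multiset. restrict (count t) (UNIV - {k0}))"
  have count_k0: "count t k0 = n - (\<Sum>k\<in>UNIV - {k0}. count t k)" if "t \<in> mset ` blocks n" for t
  proof -
    have "n = size t" using that by (auto simp: blocks_def)
    also have "\<dots> = (\<Sum>k\<in>UNIV. count t k)"
      unfolding size_multiset_overloaded_eq by (intro sum.mono_neutral_left) (auto simp: not_in_iff)
    also have "\<dots> = count t k0 + (\<Sum>k\<in>UNIV - {k0}. count t k)"
      by (simp add: sum.remove)
    finally show ?thesis by simp
  qed
  have "inj_on \<Phi> (mset ` blocks n)"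
  proof (rule inj_onI, rule multiset_eqI)
    fix t t' k assume t: "t \<in> mset ` blocks n" "t' \<in> mset ` blocks n" and eq: "\<Phi> t = \<Phi> t'"
    have *: "count t k = count t' k" if "k \<noteq> k0" for k
      using fun_cong[OF eq, of k] that by (simp add: \<Phi>_def)
    then show "count t k = count t' k"
      using count_k0[OF t(1)] count_k0[OF t(2)] by (cases "k = k0") (auto intro: sum.cong)
  qed
  moreover have "\<Phi> ` mset ` blocks n \<subseteq> PiE (UNIV - {k0}) (\<lambda>_. {..n})"
    by (auto simp: \<Phi>_def blocks_def split: if_splits) (metis count_le_size size_mset)
  ultimately have "card (mset ` blocks n :: 'c multiset set) \<le> card (PiE (UNIV - {k0}) (\<lambda>_. {..n}))"
    by (metis card_image card_mono finite_PiE finite finite_atMost)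
  then show ?thesis by (simp add: card_PiE card_Diff_singleton)
qed

text \<open>With both marginals prescribed, a contingency table is determined by its entries outside
  one row and one column.\<close>

lemma card_joint_types_le:
  fixes t :: "'a::finite multiset" and s :: "'b::finite multiset"
  assumes "size t \<le> n"
  shows "finite {W. image_mset fst W = t \<and> image_mset snd W = s}"
    and "card {W. image_mset fst W = t \<and> image_mset snd W = s}
           \<le> (n + 1) ^ ((CARD('a) - 1) * (CARD('b) - 1))"
proof -
  obtain j0 :: 'a where True by simp
  obtain k0 :: 'b where True by simp
  let ?G = "{W. image_mset fst W = t \<and> image_mset snd W = s}"
  let ?I = "(UNIV - {j0}) \<times> (UNIV - {k0})"
  let ?P = "PiE ?I (\<lambda>_. {..n})"
  define \<Phi> where "\<Phi> = (\<lambda>W :: ('a \<times> 'b) multiset. restrict (count W) ?I)"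
  have fst_sum: "count (image_mset fst W) j = (\<Sum>k\<in>UNIV. count W (j, k))" for W :: "('a \<times> 'b) multiset" and j
  proof -
    have "count (image_mset fst W) j = (\<Sum>p\<in>fst -` {j}. count W p)"
      unfolding count_image_mset by (intro sum.mono_neutral_left) (auto simp: not_in_iff)
    also have "fst -` {j} = Pair j ` (UNIV :: 'b set)" by auto
    finally show ?thesis by (simp add: sum.reindex inj_on_def)
  qed
  have snd_sum: "count (image_mset snd W) k = (\<Sum>j\<in>UNIV. count W (j, k))" for W :: "('a \<times> 'b) multiset" and k
  proof -
    have "count (image_mset snd W) k = (\<Sum>p\<in>snd -` {k}. count W p)"
      unfolding count_image_mset by (intro sum.mono_neutral_left) (auto simp: not_in_iff)
    also have "snd -` {k} = (\<lambda>j. (j, k)) ` (UNIV :: 'a set)" by auto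
    finally show ?thesis by (simp add: sum.reindex inj_on_def)
  qed
  have inj: "inj_on \<Phi> ?G"
  proof (rule inj_onI, rule multiset_eqI)
    fix V W p assume V: "V \<in> ?G" and W: "W \<in> ?G" and eq: "\<Phi> V = \<Phi> W"
    have inner: "count V (j, k) = count W (j, k)" if "j \<noteq> j0" "k \<noteq> k0" for j k
      using fun_cong[OF eq, of "(j, k)"] that by (simp add: \<Phi>_def)
    \<comment> \<open>Off row \<open>j0\<close>, the entry in column \<open>k0\<close> is what the
      row sum leaves over.\<close>
    have row: "count V (j, k) = count W (j, k)" if "j \<noteq> j0" for j k
    proof (cases "k = k0")
      case True
      have "(\<Sum>k\<in>UNIV. count V (j, k)) = (\<Sum>k\<in>UNIV. count W (j, k))"
        using V W fst_sum[of V j] fst_sum[of W j] by simp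
      moreover have "(\<Sum>k\<in>UNIV - {k0}. count V (j, k)) = (\<Sum>k\<in>UNIV - {k0}. count W (j, k))"
        using inner that by (intro sum.cong) auto
      ultimately show ?thesis
        using True by (simp add: sum.remove[of UNIV k0])
    qed (use inner that in auto)
    \<comment> \<open>Row \<open>j0\<close> then follows from the column sums.\<close>
    have "count V (j, k) = count W (j, k)" for j k
    proof (cases "j = j0")
      case True
      have "(\<Sum>j\<in>UNIV. count V (j, k)) = (\<Sum>j\<in>UNIV. count W (j, k))"
        using V W snd_sum[of V k] snd_sum[of W k] by simp
      moreover have "(\<Sum>j\<in>UNIV - {j0}. count V (j, k)) = (\<Sum>j\<in>UNIV - {j0}. count W (j, k))"
        using row by (intro sum.cong) auto
      ultimately show ?thesis
        using True by (simp add: sum.remove[of UNIV j0])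
    qed (use row in auto)
    then show "count V p = count W p" by (cases p) auto
  qed
  have "count W p \<le> n" if "W \<in> ?G" for W p
  proof -
    have "count W p \<le> size W" by (rule count_le_size)
    also have "size W = size t" using that by auto
    finally show ?thesis using assms by simp
  qed
  then have sub: "\<Phi> ` ?G \<subseteq> ?P" by (auto simp: \<Phi>_def split: if_splits)
  show "finite ?G"
    using inj sub by (rule inj_on_finite) (intro finite_PiE, auto)
  have "card ?G \<le> card ?P"
    using inj sub by (rule card_inj_on_le) (intro finite_PiE, auto)
  also have "card ?P = (n + 1) ^ ((CARD('a) - 1) * (CARD('b) - 1))"
    by (simp add: card_PiE card_cartesian_product card_Diff_singleton)
  finally show "card ?G \<le> (n + 1) ^ ((CARD('a) - 1) * (CARD('b) - 1))" .
qed

section \<open>Shell sizes by double counting\<close>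

text \<open>A permutation of the positions that turns \<open>xs\<close> into \<open>xs'\<close> acts
  injectively on second components and preserves joint types. One inequality suffices, the
  hypothesis being symmetric.\<close>

lemma card_fiber_eq:
  fixes W :: "('a \<times> 'b::finite) multiset"
  assumes "mset xs = mset xs'"
  shows "card {ys. length ys = length xs \<and> mset (zip xs ys) = W}
       = card {ys. length ys = length xs' \<and> mset (zip xs' ys) = W}"
proof -
  have le: "card {ys. length ys = length us \<and> mset (zip us ys) = W}
       \<le> card {ys. length ys = length vs \<and> mset (zip vs ys) = W}"
    if uv: "mset us = mset vs" for us vs :: "'a list"
  proof -
    obtain \<pi> where \<pi>: "\<pi> permutes {..<length us}" "permute_list \<pi> us = vs"
      using mset_eq_permutation[OF uv[symmetric]] by blast
    have len: "length us = length vs" using uv by (rule mset_eq_length)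
    show ?thesis
    proof (rule card_inj_on_le[where f = "permute_list \<pi>"])
      show "inj_on (permute_list \<pi>) {ys. length ys = length us \<and> mset (zip us ys) = W}"
      proof (rule inj_onI)
        fix ys zs assume "ys \<in> {ys. length ys = length us \<and> mset (zip us ys) = W}"
          "zs \<in> {ys. length ys = length us \<and> mset (zip us ys) = W}"
        then have l: "length ys = length us" "length zs = length us" by auto
        assume eq: "permute_list \<pi> ys = permute_list \<pi> zs"
        show "ys = zs"
        proof (rule nth_equalityI)
          fix i assume i: "i < length ys"
          then obtain j where j: "j < length us" "i = \<pi> j"
            using permutes_image[OF \<pi>(1)] l by (metis imageE lessThan_iff)
          then show "ys ! i = zs ! i"
            using arg_cong[OF eq, of "\<lambda>l. l ! j"] \<pi>(1) l by (simp add: permute_list_nth)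
        qed (simp add: l)
      qed
      show "permute_list \<pi> ` {ys. length ys = length us \<and> mset (zip us ys) = W}
          \<subseteq> {ys. length ys = length vs \<and> mset (zip vs ys) = W}"
      proof safe
        fix ys assume l: "length ys = length us"
        show "length (permute_list \<pi> ys) = length vs" using l len by simp
        have "zip vs (permute_list \<pi> ys) = permute_list \<pi> (zip us ys)"
          using \<pi> l by (subst permute_list_zip[of \<pi> "{..<length us}"]) auto
        then show "mset (zip vs (permute_list \<pi> ys)) = mset (zip us ys)"
          using \<pi>(1) l by (simp add: mset_permute_list)
      qed
      show "finite {ys. length ys = length vs \<and> mset (zip vs ys) = W}"
        by (rule finite_subset[OF _ finite_blocks[of "length vs"]]) (auto simp: blocks_def)
    qed
  qed
  show ?thesis using le[OF assms] le[OF assms[symmetric]] by simp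
qed

text \<open>The first component of a pair with this joint type may be any member of
  \<open>perm_class xs\<close>, and by \<open>card_fiber_eq\<close> each has equally many
  partners.\<close>

lemma card_shell_mult_perm_class:
  fixes xs :: "'a::finite list" and ys :: "'b::finite list"
  assumes len: "length ys = length xs"
  shows "card (perm_class xs) * card (shell xs ys)
       = card {(us, vs). length us = length vs \<and> mset (zip us vs) = mset (zip xs ys)}"
proof -
  let ?W = "mset (zip xs ys)"
  have eq: "{(us, vs). length us = length vs \<and> mset (zip us vs) = ?W}
      = Sigma (perm_class xs) (\<lambda>us. {vs. length vs = length us \<and> mset (zip us vs) = ?W})"
    (is "?L = ?R")
  proof -
    have "mset us = mset xs" if "length us = length vs" "mset (zip us vs) = ?W" for us :: "'a list" and vs :: "'b list"
      using arg_cong[OF that(2), of "image_mset fst"] that(1) len by (simp flip: mset_map)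
    then show ?thesis by (auto simp: perm_class_def)
  qed
  have fin: "finite {vs. length vs = length us \<and> mset (zip us vs) = ?W}" for us :: "'a list"
    by (rule finite_subset[OF _ finite_blocks[of "length us"]]) (auto simp: blocks_def)
  have "card ?R = (\<Sum>us\<in>perm_class xs. card {vs. length vs = length us \<and> mset (zip us vs) = ?W})"
    using fin by (intro card_SigmaI) auto
  also have "\<dots> = (\<Sum>us\<in>perm_class xs. card (shell xs ys))"
    unfolding shell_def by (intro sum.cong refl card_fiber_eq) (simp add: perm_class_def)
  finally show ?thesis unfolding eq by simp
qed

lemma mset_zip_swap_iff:
  assumes "length us = length vs" "length xs = length ys"
  shows "mset (zip us vs) = mset (zip xs ys) \<longleftrightarrow> mset (zip vs us) = mset (zip ys xs)"
proof -
  have "mset (zip b a) = image_mset prod.swap (mset (zip a b))" if "length a = length b"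
    for a :: "'c list" and b :: "'d list"
    using that by (induction a b rule: list_induct2) auto
  from this[of us vs] this[of xs ys] this[of vs us] this[of ys xs] assms show ?thesis
    by (metis)
qed

text \<open>Both products count the pairs of one joint type, once from each coordinate. This trades
  the reproductions around a source block for the source blocks around a reproduction.\<close>

lemma shell_double_count:
  fixes xs :: "'a::finite list" and ys :: "'b::finite list"
  assumes len: "length ys = length xs"
  shows "card (perm_class xs) * card (shell xs ys) = card (perm_class ys) * card (shell ys xs)"
proof -
  have "card {(us :: 'a list, vs :: 'b list). length us = length vs \<and> mset (zip us vs) = mset (zip xs ys)}
      = card (prod.swap ` {(vs :: 'b list, us :: 'a list). length vs = length us \<and> mset (zip vs us) = mset (zip ys xs)})"
    using mset_zip_swap_iff len by (intro arg_cong[where f = card]) (fastforce simp: image_iff)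
  also have "\<dots> = card {(vs :: 'b list, us :: 'a list). length vs = length us \<and> mset (zip vs us) = mset (zip ys xs)}"
    by (intro card_image) simp
  finally show ?thesis
    using card_shell_mult_perm_class[OF len] card_shell_mult_perm_class[OF len[symmetric]] by simp
qed

section \<open>One enumeration that meets every shell early\<close>

text \<open>Random coding with a union bound: \<open>small\<close> says that independent
  \<open>Q\<close>-random draws miss fewer than one set on average. The deadline \<open>m S\<close>
  varies with the set, so that heavy sets are met sooner.\<close>

lemma covering_sequence:
  fixes Q :: "'c \<Rightarrow> real" and F :: "'c set set" and m :: "'c set \<Rightarrow> nat"
  assumes fin: "finite \<Omega>" "finite F" and sub: "\<And>S. S \<in> F \<Longrightarrow> S \<subseteq> \<Omega>"
    and Q: "\<And>y. y \<in> \<Omega> \<Longrightarrow> Q y \<ge> 0" "sum Q \<Omega> = 1"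
    and small: "(\<Sum>S\<in>F. (1 - sum Q S) ^ m S) < 1"
  shows "\<exists>Y. (\<forall>i. Y i \<in> \<Omega>) \<and> (\<forall>S\<in>F. \<exists>i<m S. Y i \<in> S)"
proof -
  define unhit where "unhit = (\<lambda>l :: 'c list. {S \<in> F. set l \<inter> S = {}})"
  \<comment> \<open>Expected number of sets missed up to their deadline \<open>m S\<close> by independent \<open>Q\<close>-random continuations of \<open>l\<close>: some next
    element does not increase it (method of conditional expectations).\<close>
  define pot where "pot = (\<lambda>l. \<Sum>S\<in>unhit l. (1 - sum Q S) ^ (m S - length l))"
  have q_le: "sum Q S \<le> 1" if "S \<in> F" for S
    using sum_mono2[OF fin(1) sub[OF that], of Q] Q by auto
  \<comment> \<open>Once the deadline of an unhit set has passed, truncated subtraction makes its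
    exponent 0 and its summand 1, which \<open>pot l < 1\<close> excludes.\<close>
  have long: "length l < m S" if "pot l < 1" "S \<in> unhit l" for l S
  proof (rule ccontr)
    assume "\<not> length l < m S"
    then have "1 = (1 - sum Q S) ^ (m S - length l)" by simp
    also have "\<dots> \<le> pot l"
      unfolding pot_def using that(2) fin q_le by (intro member_le_sum) (auto simp: unhit_def)
    finally show False using that by simp
  qed
  \<comment> \<open>The \<open>Q\<close>-average of \<open>pot (y # l)\<close> over \<open>y\<close>
    equals \<open>pot l\<close>, so the values cannot all be at least 1.\<close>
  have step: "\<exists>y\<in>\<Omega>. pot (y # l) < 1" if "pot l < 1" for l
  proof (rule ccontr)
    assume "\<not> ?thesis"
    then have ge: "pot (y # l) \<ge> 1" if "y \<in> \<Omega>" for y using that by force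
    have "1 = (\<Sum>y\<in>\<Omega>. Q y * 1)" using Q by simp
    also have "\<dots> \<le> (\<Sum>y\<in>\<Omega>. Q y * pot (y # l))"
      using ge Q by (intro sum_mono mult_left_mono) auto
    also have "\<dots> = (\<Sum>y\<in>\<Omega>. \<Sum>S\<in>unhit l. if y \<in> S then 0 else Q y * (1 - sum Q S) ^ (m S - Suc (length l)))"
    proof (intro sum.cong refl)
      fix y
      have "pot (y # l) = (\<Sum>S\<in>unhit l. if y \<in> S then 0 else (1 - sum Q S) ^ (m S - Suc (length l)))"
        unfolding pot_def using fin by (intro sum.mono_neutral_cong_left) (auto simp: unhit_def)
      then show "Q y * pot (y # l) = (\<Sum>S\<in>unhit l. if y \<in> S then 0 else Q y * (1 - sum Q S) ^ (m S - Suc (length l)))"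
        by (auto simp: sum_distrib_left intro!: sum.cong)
    qed
    also have "\<dots> = (\<Sum>S\<in>unhit l. \<Sum>y\<in>\<Omega>. if y \<in> S then 0 else Q y * (1 - sum Q S) ^ (m S - Suc (length l)))"
      by (rule sum.swap)
    also have "\<dots> = pot l"
      unfolding pot_def
    proof (intro sum.cong refl)
      fix S assume S: "S \<in> unhit l"
      then have SF: "S \<in> F" by (simp add: unhit_def)
      have "(\<Sum>y\<in>\<Omega>. if y \<in> S then 0 else Q y * (1 - sum Q S) ^ (m S - Suc (length l)))
          = (\<Sum>y\<in>\<Omega> - S. Q y * (1 - sum Q S) ^ (m S - Suc (length l)))"
        using fin by (intro sum.mono_neutral_cong_right) auto
      also have "\<dots> = sum Q (\<Omega> - S) * (1 - sum Q S) ^ (m S - Suc (length l))"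
        by (simp add: sum_distrib_right)
      also have "sum Q (\<Omega> - S) = 1 - sum Q S"
        using sum_diff[OF fin(1) sub[OF SF], of Q] Q by simp
      \<comment> \<open>The mass outside \<open>S\<close> supplies the missing factor;
        \<open>long\<close> ensures that the exponent really dropped by one.\<close>
      also have "(1 - sum Q S) * (1 - sum Q S) ^ (m S - Suc (length l)) = (1 - sum Q S) ^ (m S - length l)"
        using long[OF that S] by (simp add: Suc_diff_Suc flip: power_Suc)
      finally show "(\<Sum>y\<in>\<Omega>. if y \<in> S then 0 else Q y * (1 - sum Q S) ^ (m S - Suc (length l)))
          = (1 - sum Q S) ^ (m S - length l)" .
    qed
    finally show False using that by simp
  qed
  define next_pt where "next_pt = (\<lambda>l. SOME y. y \<in> \<Omega> \<and> pot (y # l) < 1)"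
  define hist where "hist = rec_nat [] (\<lambda>_ l. next_pt l # l)"
  have hist_simps: "hist 0 = []" "hist (Suc i) = next_pt (hist i) # hist i" for i
    by (simp_all add: hist_def)
  have next_pt: "next_pt l \<in> \<Omega> \<and> pot (next_pt l # l) < 1" if "pot l < 1" for l
    using someI_ex[of "\<lambda>y. y \<in> \<Omega> \<and> pot (y # l) < 1"] step[OF that]
    unfolding next_pt_def by blast
  have pot_hist: "pot (hist i) < 1" for i
  proof (induction i)
    case 0
    show ?case using small by (simp add: hist_simps pot_def unhit_def)
  next
    case (Suc i)
    then show ?case using next_pt by (simp add: hist_simps(2))
  qed
  have len_hist: "length (hist i) = i" for i by (induction i) (auto simp: hist_simps)
  have set_hist: "set (hist i) = (\<lambda>j. next_pt (hist j)) ` {..<i}" for i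
    by (induction i) (auto simp: hist_simps lessThan_Suc)
  have "\<exists>i<m S. next_pt (hist i) \<in> S" if "S \<in> F" for S
  proof (rule ccontr)
    assume "\<not> ?thesis"
    then have "S \<in> unhit (hist (m S))" using that by (auto simp: unhit_def set_hist)
    from long[OF pot_hist this] show False by (simp add: len_hist)
  qed
  moreover have "next_pt (hist i) \<in> \<Omega>" for i using next_pt[OF pot_hist] by blast
  ultimately show ?thesis
    by (intro exI[of _ "\<lambda>i. next_pt (hist i)"]) blast
qed

text \<open>Repetitions are removed from the covering sequence: the rank of an element is the number
  of distinct elements before its first occurrence. Positions can only decrease, so the deadlines
  survive, and ranks stay below \<open>card \<Omega>\<close>, which will bound the header of a
  codeword.\<close>

lemma covering_rank:
  fixes Q :: "'c \<Rightarrow> real" and F :: "'c set set" and m :: "'c set \<Rightarrow> nat"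
  assumes fin: "finite \<Omega>" "finite F" and sub: "\<And>S. S \<in> F \<Longrightarrow> S \<subseteq> \<Omega>"
    and Q: "\<And>y. y \<in> \<Omega> \<Longrightarrow> Q y \<ge> 0" "sum Q \<Omega> = 1"
    and small: "(\<Sum>S\<in>F. (1 - sum Q S) ^ m S) < 1"
  shows "\<exists>B r. B \<subseteq> \<Omega> \<and> inj_on r B \<and> (\<forall>y\<in>B. r y < card \<Omega>) \<and> (\<forall>S\<in>F. \<exists>y\<in>B \<inter> S. r y < m S)"
proof -
  obtain Y where Y: "\<And>i. Y i \<in> \<Omega>" "\<And>S. S \<in> F \<Longrightarrow> \<exists>i<m S. Y i \<in> S"
    using covering_sequence[OF assms] by blast
  define first where "first = (\<lambda>y. LEAST i. Y i = y)"
  define r where "r = (\<lambda>y. card (Y ` {..<first y}))"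
  have Y_first: "Y (first y) = y" if "y \<in> range Y" for y
    using that unfolding first_def by (auto intro: LeastI_ex)
  have not_before: "Y i \<noteq> y" if "i < first y" for i y
    using that not_less_Least unfolding first_def by blast
  have r_less: "r y < r z" if "first y < first z" "y \<in> range Y" for y z
  proof -
    have "Y (first y) \<notin> Y ` {..<first y}"
      using not_before Y_first[OF that(2)] by (metis imageE lessThan_iff)
    moreover have "insert (Y (first y)) (Y ` {..<first y}) \<subseteq> Y ` {..<first z}" using that by auto
    ultimately show ?thesis unfolding r_def by (intro psubset_card_mono) auto
  qed
  have "inj_on r (range Y)"
  proof (rule inj_onI)
    fix y z assume yz: "y \<in> range Y" "z \<in> range Y" and "r y = r z"
    then have "first y = first z" using r_less[of y z] r_less[of z y] by linarith
    then show "y = z" using Y_first[OF yz(1)] Y_first[OF yz(2)] by metis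
  qed
  moreover have "r y < card \<Omega>" if "y \<in> range Y" for y
    unfolding r_def
  proof (rule psubset_card_mono[OF fin(1)])
    have "y \<notin> Y ` {..<first y}" using not_before by blast
    moreover have "y \<in> \<Omega>" using Y(1) that by auto
    moreover have "Y ` {..<first y} \<subseteq> \<Omega>" using Y(1) by auto
    ultimately show "Y ` {..<first y} \<subset> \<Omega>" by blast
  qed
  moreover have "\<exists>y\<in>range Y \<inter> S. r y < m S" if "S \<in> F" for S
  proof -
    obtain i where i: "i < m S" "Y i \<in> S" using Y(2)[OF \<open>S \<in> F\<close>] by blast
    have "r (Y i) \<le> first (Y i)" unfolding r_def using card_image_le[of "{..<first (Y i)}" Y] by simp
    also have "\<dots> \<le> i" unfolding first_def by (rule Least_le) simp
    finally show ?thesis using i by (intro bexI[of _ "Y i"]) auto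
  qed
  ultimately show ?thesis using Y(1) by (intro exI[of _ "range Y"] exI[of _ r]) auto
qed

section \<open>A prefix code for ranks\<close>

text \<open>\<open>l\<close> is the number of binary digits of \<open>k\<close>, with none for 0.
  The factor 2 is paid once for the header and once for the rank, which explains
  \<open>2 * ln 2\<close> in the codeword length.\<close>

lemma dyadic_exponent:
  fixes k :: nat
  obtains l where "k < 2 ^ l" "2 ^ l \<le> 2 * (k + 1)" "\<And>D. k < 2 ^ D \<Longrightarrow> l \<le> D"
proof
  define l where "l = (LEAST l. k < (2::nat) ^ l)"
  show "k < 2 ^ l" unfolding l_def by (rule LeastI) (rule less_exp)
  show "l \<le> D" if "k < 2 ^ D" for D unfolding l_def using that by (rule Least_le)
  show "2 ^ l \<le> 2 * (k + 1)"
  proof (cases l)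
    case (Suc l')
    then have "\<not> k < 2 ^ l'" using not_less_Least[of l' "\<lambda>l. k < (2::nat) ^ l"] unfolding l_def by simp
    then show ?thesis using Suc by simp
  qed simp
qed

lemma binary_words: "\<exists>b :: nat \<Rightarrow> bool list. inj_on b {..<2 ^ l} \<and> (\<forall>i<2 ^ l. length (b i) = l)"
proof -
  have "card {..<(2::nat) ^ l} = card {bs :: bool list. length bs = l}"
    using card_lists_length_eq[of "UNIV :: bool set" l] by simp
  then obtain b where "bij_betw b {..<(2::nat) ^ l} {bs :: bool list. length bs = l}"
    using finite_same_card_bij[of "{..<(2::nat) ^ l}" "{bs :: bool list. length bs = l}"]
      finite_lists_length_eq[of "UNIV :: bool set" l] by auto
  then show ?thesis by (intro exI[of _ b]) (auto simp: bij_betw_def)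
qed

text \<open>A codeword is a header of fixed length that announces how many bits of the rank follow.\<close>

lemma prefix_code_of_rank:
  assumes inj: "inj_on r B" and less: "\<And>y. y \<in> B \<Longrightarrow> r y < 2 ^ D"
  shows "\<exists>f :: 'c \<Rightarrow> bool list. inj_on f B \<and> prefix_free (f ` B) \<and>
           (\<forall>y\<in>B. real (length (f y)) * ln 2 \<le> 2 * ln 2 + ln (real D + 1) + ln (real (r y) + 1))"
proof -
  \<comment> \<open>A header of \<open>h\<close> bits suffices, since every announced length is at
    most \<open>D < 2 ^ h\<close>.\<close>
  obtain h where h: "D < 2 ^ h" "2 ^ h \<le> 2 * (D + 1)" using dyadic_exponent[of D] by metis
  have "\<forall>k. \<exists>l. k < 2 ^ l \<and> (2::nat) ^ l \<le> 2 * (k + 1) \<and> (\<forall>D. k < 2 ^ D \<longrightarrow> l \<le> D)"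
    using dyadic_exponent by metis
  then obtain L where L: "\<And>k. k < 2 ^ L k" "\<And>k. (2::nat) ^ L k \<le> 2 * (k + 1)" "\<And>k D. k < 2 ^ D \<Longrightarrow> L k \<le> D"
    by metis
  have "\<forall>l. \<exists>b :: nat \<Rightarrow> bool list. inj_on b {..<2 ^ l} \<and> (\<forall>i<2 ^ l. length (b i) = l)"
    using binary_words by blast
  then obtain b :: "nat \<Rightarrow> nat \<Rightarrow> bool list" where
    b: "\<And>l. inj_on (b l) {..<2 ^ l}" "\<And>l i. i < 2 ^ l \<Longrightarrow> length (b l i) = l" by metis
  define f where "f = (\<lambda>y. b h (L (r y)) @ b (L (r y)) (r y))"
  have head: "L (r y) < 2 ^ h" if "y \<in> B" for y
    using L(3)[OF less[OF that]] h by simp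
  \<comment> \<open>The headers have equal length, hence coincide and announce equal lengths for the
    ranks; nothing is left for \<open>w\<close>, and the ranks agree. Since \<open>prefix\<close> is
    reflexive, this also gives injectivity.\<close>
  have pre: "y = z" if pfx: "prefix (f y) (f z)" and yz: "y \<in> B" "z \<in> B" for y z
  proof -
    obtain w where w: "f z = f y @ w" using pfx by (auto simp: prefix_def)
    have hd: "length (b h (L (r y))) = length (b h (L (r z)))" using b(2) head yz by simp
    then have split: "b h (L (r y)) = b h (L (r z))" "b (L (r z)) (r z) = b (L (r y)) (r y) @ w"
      using w by (auto simp: f_def)
    have eq: "L (r y) = L (r z)"
      using inj_onD[OF b(1)[of h] split(1)] head yz by auto
    have "length (b (L (r z)) (r z)) = length (b (L (r y)) (r y))"
      using b(2)[OF L(1)[of "r y"]] b(2)[OF L(1)[of "r z"]] eq by simp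
    then have "b (L (r z)) (r z) = b (L (r z)) (r y)" using split(2) eq by simp
    moreover have "r y < 2 ^ L (r z)" "r z < 2 ^ L (r z)" using L(1) eq by metis+
    ultimately have "r z = r y" using inj_onD[OF b(1)[of "L (r z)"]] by auto
    then show ?thesis using inj yz by (simp add: inj_on_eq_iff)
  qed
  have "real (length (f y)) * ln 2 \<le> 2 * ln 2 + ln (real D + 1) + ln (real (r y) + 1)" if "y \<in> B" for y
  proof -
    have "real (length (f y)) * ln 2 = ln (2 ^ h * 2 ^ L (r y))"
      using b(2) head[OF that] L(1) by (simp add: f_def ln_mult ln_realpow algebra_simps)
    also have "\<dots> \<le> ln ((2 * (real D + 1)) * (2 * (real (r y) + 1)))"
    proof (subst ln_le_cancel_iff)
      have "real (2 ^ h) \<le> real (2 * (D + 1))" using h(2) by (rule of_nat_mono)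
      moreover have "real (2 ^ L (r y)) \<le> real (2 * (r y + 1))" using L(2) by (rule of_nat_mono)
      ultimately show "2 ^ h * 2 ^ L (r y) \<le> (2 * (real D + 1)) * (2 * (real (r y) + 1))"
        by (intro mult_mono) auto
    qed auto
    also have "\<dots> = 2 * ln 2 + ln (real D + 1) + ln (real (r y) + 1)"
      using ln_mult_pos[of 2 "real D + 1"] ln_mult_pos[of 2 "real (r y) + 1"]
      by (subst ln_mult_pos) auto
    finally show ?thesis .
  qed
  moreover have "inj_on f B" using pre by (auto intro!: inj_onI)
  moreover have "prefix_free (f ` B)" using pre by (auto simp: prefix_free_def)
  ultimately show ?thesis by blast
qed

section \<open>Entropy lower bound for quantizers\<close>

text \<open>Conditioning reduces entropy: the right-hand side is the conditional entropy of \<open>\<phi>\<close> given \<open>\<tau>\<close>.\<close>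

lemma entropy_map_pmf_ge_conditional:
  fixes v :: "'x pmf" and \<phi> :: "'x \<Rightarrow> 'y::countable" and \<tau> :: "'x \<Rightarrow> 'z"
  assumes fin: "finite (set_pmf v)"
  shows "entropy_pmf (map_pmf \<phi> v) \<ge> (\<Sum>x\<in>set_pmf v. pmf v x *
           ln (measure v {x'. \<tau> x' = \<tau> x} / measure v {x'. \<tau> x' = \<tau> x \<and> \<phi> x' = \<phi> x}))"
proof -
  let ?X = "set_pmf v"
  define A where "A = (\<lambda>a. measure v {x. \<tau> x = a})"
  define B where "B = (\<lambda>a b. measure v {x. \<tau> x = a \<and> \<phi> x = b})"
  define P where "P = (\<lambda>b. measure v {x. \<phi> x = b})"
  have meas: "measure v {x. S x} = (\<Sum>x\<in>{x \<in> ?X. S x}. pmf v x)" for S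
  proof -
    have "measure v {x. S x} = measure v ({x. S x} \<inter> ?X)" by (rule measure_Int_set_pmf[symmetric])
    also have "\<dots> = (\<Sum>x\<in>{x. S x} \<inter> ?X. pmf v x)" using fin by (intro measure_measure_pmf_finite) auto
    also have "{x. S x} \<inter> ?X = {x \<in> ?X. S x}" by auto
    finally show ?thesis .
  qed
  have pos: "measure v {x. S x} > 0" if "x \<in> ?X" "S x" for S x
    unfolding meas using that fin by (intro sum_pos2[of _ x]) (auto simp: pmf_positive)
  have total: "sum (pmf v) ?X = 1" using fin by (rule sum_pmf_eq_1) simp
  have "entropy_pmf (map_pmf \<phi> v) = (\<Sum>b\<in>\<phi> ` ?X. - (P b * ln (P b)))"
    using fin by (subst entropy_pmf_eq_sum) (auto simp: pmf_map P_def vimage_def sum_negf)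
  also have "\<dots> = (\<Sum>b\<in>\<phi> ` ?X. \<Sum>x\<in>{x \<in> ?X. \<phi> x = b}. - (pmf v x * ln (P (\<phi> x))))"
    by (intro sum.cong refl) (subst P_def, subst meas, simp add: sum_distrib_right sum_negf)
  also have "\<dots> = (\<Sum>x\<in>?X. - (pmf v x * ln (P (\<phi> x))))"
    using sum.image_gen[OF fin, of "\<lambda>x. - (pmf v x * ln (P (\<phi> x)))" \<phi>] by simp
  finally have H: "entropy_pmf (map_pmf \<phi> v) = - (\<Sum>x\<in>?X. pmf v x * ln (P (\<phi> x)))"
    by (simp add: sum_negf)
  have "(\<Sum>x\<in>?X. pmf v x * ln (A (\<tau> x) / B (\<tau> x) (\<phi> x))) + (\<Sum>x\<in>?X. pmf v x * ln (P (\<phi> x)))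
      = (\<Sum>x\<in>?X. pmf v x * (ln (A (\<tau> x) / B (\<tau> x) (\<phi> x)) + ln (P (\<phi> x))))"
    by (simp add: sum.distrib algebra_simps)
  \<comment> \<open>Mutual information is nonnegative: \<open>ln z \<le> z - 1\<close> is applied to
    the ratio \<open>z\<close> of the product of the marginals to the joint probability, whose mean
    is then shown to be at most 1.\<close>
  also have "\<dots> \<le> (\<Sum>x\<in>?X. pmf v x * (A (\<tau> x) / B (\<tau> x) (\<phi> x) * P (\<phi> x) - 1))"
  proof (intro sum_mono mult_left_mono)
    fix x assume x: "x \<in> ?X"
    have p: "A (\<tau> x) > 0" "B (\<tau> x) (\<phi> x) > 0" "P (\<phi> x) > 0"
      unfolding A_def B_def P_def using pos[OF x] by auto
    then have "ln (A (\<tau> x) / B (\<tau> x) (\<phi> x)) + ln (P (\<phi> x)) = ln (A (\<tau> x) / B (\<tau> x) (\<phi> x) * P (\<phi> x))"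
      by (intro ln_mult_pos[symmetric]) auto
    also have "\<dots> \<le> A (\<tau> x) / B (\<tau> x) (\<phi> x) * P (\<phi> x) - 1"
      using p by (intro ln_le_minus_one) auto
    finally show "ln (A (\<tau> x) / B (\<tau> x) (\<phi> x)) + ln (P (\<phi> x)) \<le> A (\<tau> x) / B (\<tau> x) (\<phi> x) * P (\<phi> x) - 1" .
  qed simp
  also have "\<dots> = (\<Sum>x\<in>?X. pmf v x * (A (\<tau> x) / B (\<tau> x) (\<phi> x) * P (\<phi> x))) - 1"
    using total by (simp add: right_diff_distrib sum_subtractf)
  also have "(\<Sum>x\<in>?X. pmf v x * (A (\<tau> x) / B (\<tau> x) (\<phi> x) * P (\<phi> x)))
      = (\<Sum>c\<in>(\<lambda>x. (\<tau> x, \<phi> x)) ` ?X. \<Sum>x\<in>{x \<in> ?X. (\<tau> x, \<phi> x) = c}. pmf v x * (A (\<tau> x) / B (\<tau> x) (\<phi> x) * P (\<phi> x)))"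
    by (rule sum.image_gen[OF fin])
  also have "\<dots> = (\<Sum>c\<in>(\<lambda>x. (\<tau> x, \<phi> x)) ` ?X. A (fst c) * P (snd c))"
  proof (intro sum.cong refl)
    fix c assume "c \<in> (\<lambda>x. (\<tau> x, \<phi> x)) ` ?X"
    then obtain x where x: "x \<in> ?X" "c = (\<tau> x, \<phi> x)" by auto
    have "(\<Sum>x\<in>{x \<in> ?X. (\<tau> x, \<phi> x) = c}. pmf v x * (A (\<tau> x) / B (\<tau> x) (\<phi> x) * P (\<phi> x)))
        = (\<Sum>x\<in>{x \<in> ?X. \<tau> x = fst c \<and> \<phi> x = snd c}. pmf v x) * (A (fst c) / B (fst c) (snd c) * P (snd c))"
      unfolding sum_distrib_right by (intro sum.cong) auto
    also have "(\<Sum>x\<in>{x \<in> ?X. \<tau> x = fst c \<and> \<phi> x = snd c}. pmf v x) = B (fst c) (snd c)"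
      by (simp add: B_def meas)
    also have "B (fst c) (snd c) * (A (fst c) / B (fst c) (snd c) * P (snd c)) = A (fst c) * P (snd c)"
      using pos[OF x(1), of "\<lambda>x'. \<tau> x' = fst c \<and> \<phi> x' = snd c"] x(2) by (simp add: B_def)
    finally show "(\<Sum>x\<in>{x \<in> ?X. (\<tau> x, \<phi> x) = c}. pmf v x * (A (\<tau> x) / B (\<tau> x) (\<phi> x) * P (\<phi> x)))
        = A (fst c) * P (snd c)" .
  qed
  \<comment> \<open>Passing from the attained pairs to all pairs makes the sum a product of two
    total masses.\<close>
  also have "\<dots> \<le> (\<Sum>c\<in>\<tau> ` ?X \<times> \<phi> ` ?X. A (fst c) * P (snd c))"
    using fin by (intro sum_mono2) (auto simp: A_def P_def)
  also have "\<dots> = (\<Sum>a\<in>\<tau> ` ?X. A a) * (\<Sum>b\<in>\<phi> ` ?X. P b)"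
    by (simp add: sum_product sum.cartesian_product case_prod_beta)
  also have "(\<Sum>a\<in>\<tau> ` ?X. A a) = 1"
    unfolding A_def meas using sum.image_gen[OF fin, of "pmf v" \<tau>] total by simp
  also have "(\<Sum>b\<in>\<phi> ` ?X. P b) = 1"
    unfolding P_def meas using sum.image_gen[OF fin, of "pmf v" \<phi>] total by simp
  finally show ?thesis unfolding H A_def B_def by simp
qed

text \<open>This is \<open>M\<close> for the type \<open>T = perm_class xs\<close>; it depends on
  \<open>xs\<close> only through that type.\<close>

definition max_covered :: "nat \<Rightarrow> real \<Rightarrow> ('a \<Rightarrow> 'b::finite \<Rightarrow> real) \<Rightarrow> 'a list \<Rightarrow> nat" where
  "max_covered n d \<rho> xs =
     Max ((\<lambda>ys. card {us \<in> perm_class xs. block_distortion n \<rho> us ys \<le> d}) ` blocks n)"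

lemma max_covered_ge:
  "ys \<in> blocks n \<Longrightarrow> card {us \<in> perm_class xs. block_distortion n \<rho> us ys \<le> d} \<le> max_covered n d \<rho> xs"
  unfolding max_covered_def by (intro Max_ge) auto

lemma pmf_replicate_pmf:
  "pmf (replicate_pmf (length xs) p) xs = prod_list (map (pmf p) xs)"
proof (induction xs)
  case (Cons x xs)
  have "replicate_pmf (length (x # xs)) p
      = map_pmf (\<lambda>(y, ys). y # ys) (pair_pmf p (replicate_pmf (length xs) p))"
    by (simp add: pair_pmf_def map_bind_pmf)
  also have "pmf \<dots> (x # xs) = pmf (pair_pmf p (replicate_pmf (length xs) p)) (x, xs)"
    using pmf_map_inj'[of "\<lambda>(y, ys). y # ys" "pair_pmf p (replicate_pmf (length xs) p)" "(x, xs)"]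
    by (simp add: inj_def)
  finally show ?case by (simp add: pmf_pair Cons.IH)
qed simp

text \<open>The product probability depends only on the type, so the source is uniform given its
  type.\<close>

lemma pmf_replicate_perm:
  assumes "mset xs = mset ys"
  shows "pmf (replicate_pmf n p) xs = pmf (replicate_pmf n p) ys"
proof -
  have "prod_list (map (pmf p) xs) = prod_list (map (pmf p) ys)"
    by (metis assms mset_map prod_mset_prod_list)
  moreover have "pmf (replicate_pmf n p) zs = 0" if "length zs \<noteq> n" for zs
    using that by (simp add: pmf_eq_0_set_pmf set_replicate_pmf)
  ultimately show ?thesis
    using mset_eq_length[OF assms] by (cases "length xs = n") 
      (auto simp: pmf_replicate_pmf[of xs p, symmetric] pmf_replicate_pmf[of ys p, symmetric])
qed

lemma set_replicate_pmf_blocks: "set_pmf (replicate_pmf n p) \<subseteq> blocks n"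
  by (auto simp: set_replicate_pmf blocks_def)

text \<open>Conditioning is on the type, \<open>\<tau> = mset\<close>. By uniformity the ratio of
  probabilities becomes a ratio of cardinalities.\<close>

lemma entropy_quantizer_ge:
  fixes \<rho> :: "'a::finite \<Rightarrow> 'b::finite \<Rightarrow> real"
  assumes \<phi>: "\<phi> \<in> d_quantizers n d \<rho>"
  shows "measure_pmf.expectation (replicate_pmf n p)
           (\<lambda>xs. ln (real (card (perm_class xs)) / real (max_covered n d \<rho> xs)))
         \<le> entropy_pmf (map_pmf \<phi> (replicate_pmf n p))"
proof -
  let ?v = "replicate_pmf n p"
  have fin: "finite (set_pmf ?v)"
    using set_replicate_pmf_blocks finite_blocks by (rule finite_subset)
  have le: "ln (real (card (perm_class xs)) / real (max_covered n d \<rho> xs))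
      \<le> ln (measure ?v {x'. mset x' = mset xs} / measure ?v {x'. mset x' = mset xs \<and> \<phi> x' = \<phi> xs})"
    if xs: "xs \<in> set_pmf ?v" for xs
  proof -
    have block: "xs \<in> blocks n" using xs set_replicate_pmf_blocks by blast
    have meas: "measure ?v S = real (card S) * pmf ?v xs" if "S \<subseteq> perm_class xs" for S
    proof -
      have "measure ?v S = sum (pmf ?v) S"
        using that by (intro measure_measure_pmf_finite) (rule finite_subset, auto)
      also have "\<dots> = (\<Sum>_\<in>S. pmf ?v xs)"
        using that by (intro sum.cong refl pmf_replicate_perm) (auto simp: perm_class_def)
      finally show ?thesis by simp
    qed
    let ?S = "{x'. mset x' = mset xs \<and> \<phi> x' = \<phi> xs}"
    have sub: "?S \<subseteq> perm_class xs" by (auto simp: perm_class_def)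
    \<comment> \<open>Members of the type with a common image all lie within \<open>d\<close> of it,
      so \<open>max_covered\<close> bounds their number.\<close>
    have "?S \<subseteq> {us \<in> perm_class xs. block_distortion n \<rho> us (\<phi> xs) \<le> d}"
    proof safe
      fix us assume us: "mset us = mset xs" "\<phi> us = \<phi> xs"
      show "us \<in> perm_class xs" using us by (simp add: perm_class_def)
      then have "us \<in> blocks n" using perm_class_subset_blocks[OF block] by blast
      then show "block_distortion n \<rho> us (\<phi> xs) \<le> d"
        using \<phi> us(2) by (auto simp: d_quantizers_def)
    qed
    then have "card ?S \<le> card {us \<in> perm_class xs. block_distortion n \<rho> us (\<phi> xs) \<le> d}"
      by (intro card_mono) auto
    also have "\<dots> \<le> max_covered n d \<rho> xs"
      using \<phi> block by (intro max_covered_ge) (auto simp: d_quantizers_def)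
    finally have card_le: "card ?S \<le> max_covered n d \<rho> xs" .
    have "card ?S > 0" using finite_subset[OF sub] by (auto simp: card_gt_0_iff)
    have "real (card (perm_class xs)) / real (max_covered n d \<rho> xs) \<le> real (card (perm_class xs)) / real (card ?S)"
      using card_le \<open>card ?S > 0\<close> by (intro divide_left_mono) auto
    also have "\<dots> = measure ?v (perm_class xs) / measure ?v ?S"
      using meas[OF sub] meas[of "perm_class xs"] pmf_positive[OF xs] by simp
    finally show ?thesis
      using card_le \<open>card ?S > 0\<close> card_perm_class_pos[of xs] by (intro ln_mono) (auto simp: perm_class_def)
  qed
  have "measure_pmf.expectation ?v (\<lambda>xs. ln (real (card (perm_class xs)) / real (max_covered n d \<rho> xs)))
      = (\<Sum>xs\<in>set_pmf ?v. pmf ?v xs * ln (real (card (perm_class xs)) / real (max_covered n d \<rho> xs)))"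
    using fin by (subst integral_measure_pmf_real[of "set_pmf ?v"]) (auto simp: mult.commute)
  also have "\<dots> \<le> (\<Sum>xs\<in>set_pmf ?v. pmf ?v xs *
      ln (measure ?v {x'. mset x' = mset xs} / measure ?v {x'. mset x' = mset xs \<and> \<phi> x' = \<phi> xs}))"
    using le by (intro sum_mono mult_left_mono) auto
  also have "\<dots> \<le> entropy_pmf (map_pmf \<phi> ?v)"
    by (rule entropy_map_pmf_ge_conditional[OF fin])
  finally show ?thesis .
qed

section \<open>A heavy admissible shell around every source block\<close>

text \<open>A sum of single-letter costs sees only the joint type, so the \<open>d\<close>-ball
  around \<open>xs\<close> is a union of shells.\<close>

lemma block_distortion_cong:
  assumes "xs \<in> blocks n" "ys \<in> blocks n" "us \<in> blocks n" "vs \<in> blocks n"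
    and "mset (zip xs ys) = mset (zip us vs)"
  shows "block_distortion n \<rho> xs ys = block_distortion n \<rho> us vs"
proof -
  have "(\<Sum>i<n. \<rho> (xs ! i) (ys ! i)) = sum_mset (image_mset (\<lambda>(j, k). \<rho> j k) (mset (zip xs ys)))"
    if "xs \<in> blocks n" "ys \<in> blocks n" for xs ys
  proof -
    have "(\<Sum>i<n. \<rho> (xs ! i) (ys ! i)) = sum_list (map (\<lambda>(j, k). \<rho> j k) (zip xs ys))"
      using that by (simp add: sum_list_sum_nth blocks_def atLeast0LessThan)
    then show ?thesis by (simp flip: sum_mset_sum_list)
  qed
  from this[OF assms(1,2)] this[OF assms(3,4)] assms(5) show ?thesis
    by (simp add: block_distortion_def)
qed

text \<open>The row minima are nonnegative with maximum 0, so every source letter has a reproduction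
  letter of cost 0.\<close>

lemma zero_distortion_block:
  fixes \<rho> :: "'a::finite \<Rightarrow> 'b::finite \<Rightarrow> real"
  assumes \<rho>: "\<rho> \<in> distortion_measures" and xs: "xs \<in> blocks n"
  shows "\<exists>ys\<in>blocks n. block_distortion n \<rho> xs ys = 0"
proof -
  have "\<exists>k. \<rho> j k = 0" for j
  proof -
    have "(MIN k. \<rho> j k) \<in> range (\<rho> j)" by (intro Min_in) auto
    then obtain k where k: "\<rho> j k = (MIN k. \<rho> j k)" by (metis imageE)
    also have "\<dots> \<le> (MAX j. MIN k. \<rho> j k)" by (intro Max_ge) auto
    also have "\<dots> = 0" using \<rho> by (simp add: distortion_measures_def)
    finally show ?thesis using \<rho> by (intro exI[of _ k]) (auto simp: distortion_measures_def intro: antisym)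
  qed
  then obtain \<kappa> where "\<And>j. \<rho> j (\<kappa> j) = 0" by metis
  then show ?thesis
    using xs by (intro bexI[of _ "map \<kappa> xs"]) (auto simp: block_distortion_def blocks_def)
qed

text \<open>Pigeonhole principle, stated without division.\<close>

lemma exists_large_fiber:
  assumes "finite S" "S \<noteq> {}"
  shows "\<exists>u\<in>S. card S \<le> card (g ` S) * card {x \<in> S. g x = g u}"
proof (rule ccontr)
  assume "\<not> ?thesis"
  then have less: "card (g ` S) * card {x \<in> S. g x = c} < card S" if "c \<in> g ` S" for c
    using that by force
  have "card (g ` S) * card S = card (g ` S) * (\<Sum>c\<in>g ` S. card {x \<in> S. g x = c})"
    using sum.image_gen[OF assms(1), of "\<lambda>_. 1 :: nat" g] by simp
  also have "\<dots> = (\<Sum>c\<in>g ` S. card (g ` S) * card {x \<in> S. g x = c})"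
    by (rule sum_distrib_left)
  also have "\<dots> < (\<Sum>c\<in>g ` S. card S)"
    using less assms by (intro sum_strict_mono) auto
  finally show False by simp
qed

lemma shell_subset: "xs \<in> blocks n \<Longrightarrow> ys \<in> blocks n \<Longrightarrow> shell xs ys \<subseteq> perm_class ys"
  by (auto simp: shell_def perm_class_def blocks_def simp flip: mset_map
      dest!: arg_cong[where f = "image_mset snd"])

text \<open>A block \<open>v\<close> attaining \<open>max_covered\<close> need not be close to
  \<open>xs\<close> itself. The blocks it covers are split by their joint type with
  \<open>v\<close>, a largest part is kept, and the positions are permuted so that \<open>xs\<close>
  replaces a representative \<open>u\<close> of that part.\<close>

lemma exists_good_shell:
  fixes \<rho> :: "'a::finite \<Rightarrow> 'b::finite \<Rightarrow> real"
  assumes \<rho>: "\<rho> \<in> distortion_measures" and xs: "xs \<in> blocks n" and d: "d \<ge> 0"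
  shows "max_covered n d \<rho> xs > 0"
    and "\<exists>ys\<in>blocks n. block_distortion n \<rho> xs ys \<le> d \<and>
           max_covered n d \<rho> xs \<le> (n + 1) ^ ((CARD('a) - 1) * (CARD('b) - 1)) * card (shell ys xs)"
proof -
  obtain y0 where y0: "y0 \<in> blocks n" "block_distortion n \<rho> xs y0 = 0"
    using zero_distortion_block[OF \<rho> xs] by blast
  then have "xs \<in> {us \<in> perm_class xs. block_distortion n \<rho> us y0 \<le> d}" using d by simp
  then have "0 < card {us \<in> perm_class xs. block_distortion n \<rho> us y0 \<le> d}"
    unfolding card_gt_0_iff by (intro conjI) (blast, simp)
  also have "\<dots> \<le> max_covered n d \<rho> xs" using y0(1) by (rule max_covered_ge)
  finally show pos: "max_covered n d \<rho> xs > 0" .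
  have "max_covered n d \<rho> xs \<in> (\<lambda>ys. card {us \<in> perm_class xs. block_distortion n \<rho> us ys \<le> d}) ` blocks n"
    unfolding max_covered_def using y0(1) by (intro Max_in) auto
  then obtain v where v: "v \<in> blocks n"
    "max_covered n d \<rho> xs = card {us \<in> perm_class xs. block_distortion n \<rho> us v \<le> d}" by auto
  define S where "S = {us \<in> perm_class xs. block_distortion n \<rho> us v \<le> d}"
  have card_S: "max_covered n d \<rho> xs = card S" using v(2) by (simp add: S_def)
  have S: "finite S" "S \<noteq> {}" using card_S pos by (auto simp: card_gt_0_iff)
  obtain u where u: "u \<in> S" "card S \<le> card ((\<lambda>us. mset (zip us v)) ` S) * card {us \<in> S. mset (zip us v) = mset (zip u v)}"
    using exists_large_fiber[OF S(1,2), of "\<lambda>us. mset (zip us v)"] by blast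
  have S_blocks: "us \<in> blocks n" "mset us = mset xs" if "us \<in> S" for us
    using that perm_class_subset_blocks[OF xs] by (auto simp: S_def perm_class_def)
  have lens: "length us = length v" if "us \<in> S" for us
    using S_blocks(1)[OF that] v(1) by (simp add: blocks_def)
  have "(\<lambda>us. mset (zip us v)) ` S \<subseteq> {W. image_mset fst W = mset xs \<and> image_mset snd W = mset v}"
    using lens S_blocks(2) by (auto simp flip: mset_map)
  moreover have "size (mset xs) \<le> n" using xs by (simp add: blocks_def)
  ultimately have "card ((\<lambda>us. mset (zip us v)) ` S) \<le> (n + 1) ^ ((CARD('a) - 1) * (CARD('b) - 1))"
    using card_joint_types_le[of "mset xs" n "mset v"] by (meson card_mono le_trans)
  moreover have "card {us \<in> S. mset (zip us v) = mset (zip u v)} \<le> card (shell v u)"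
  proof (rule card_mono)
    show "finite (shell v u)"
      by (rule finite_subset[OF _ finite_blocks[of "length v"]]) (auto simp: shell_def blocks_def)
    show "{us \<in> S. mset (zip us v) = mset (zip u v)} \<subseteq> shell v u"
    proof
      fix us assume "us \<in> {us \<in> S. mset (zip us v) = mset (zip u v)}"
      then have "length us = length v" "mset (zip us v) = mset (zip u v)" using lens by auto
      then show "us \<in> shell v u"
        using mset_zip_swap_iff[of us v u v] lens[OF u(1)] by (simp add: shell_def)
    qed
  qed
  ultimately have bound: "max_covered n d \<rho> xs \<le> (n + 1) ^ ((CARD('a) - 1) * (CARD('b) - 1)) * card (shell v u)"
    unfolding card_S using u(2) by (blast intro: order_trans mult_le_mono)
  \<comment> \<open>As \<open>xs\<close> and \<open>u\<close> have the same type, this joint type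
    has as many partners for \<open>xs\<close> as for \<open>u\<close>, which has at least
    \<open>v\<close>.\<close>
  have "card {ys. length ys = length xs \<and> mset (zip xs ys) = mset (zip u v)}
      = card {ys. length ys = length u \<and> mset (zip u ys) = mset (zip u v)}"
    using S_blocks(2)[OF u(1)] by (intro card_fiber_eq) simp
  also have "\<dots> > 0"
  proof -
    have "finite {ys. length ys = length u \<and> mset (zip u ys) = mset (zip u v)}"
      by (rule finite_subset[OF _ finite_blocks[of "length u"]]) (auto simp: blocks_def)
    then show ?thesis using lens[OF u(1)] by (auto simp: card_gt_0_iff)
  qed
  finally obtain ys where ys: "length ys = length xs" "mset (zip xs ys) = mset (zip u v)"
    by (fastforce simp: card_gt_0_iff)
  have ys_block: "ys \<in> blocks n" using ys xs by (simp add: blocks_def)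
  have "mset ys = mset v"
    using arg_cong[OF ys(2), of "image_mset snd"] ys(1) lens[OF u(1)] by (simp flip: mset_map)
  moreover have "mset (zip ys xs) = mset (zip v u)"
    using ys lens[OF u(1)] mset_zip_swap_iff by metis
  ultimately have "card (shell ys xs) = card (shell v u)"
    unfolding shell_def using card_fiber_eq[of ys v "mset (zip v u)"] by simp
  moreover have "block_distortion n \<rho> xs ys \<le> d"
    using block_distortion_cong[OF xs ys_block S_blocks(1)[OF u(1)] v(1) ys(2)] u(1) by (simp add: S_def)
  ultimately show "\<exists>ys\<in>blocks n. block_distortion n \<rho> xs ys \<le> d \<and>
           max_covered n d \<rho> xs \<le> (n + 1) ^ ((CARD('a) - 1) * (CARD('b) - 1)) * card (shell ys xs)"
    using bound ys_block by auto
qed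

section \<open>Construction of the universal code\<close>

text \<open>The bound holds for each \<open>xs\<close>, and its last term is the one averaged in
  \<open>entropy_quantizer_ge\<close>. In the factor of \<open>ln (real n + 1)\<close>,
  \<open>CARD('b) - 1\<close> comes from the types, \<open>(CARD('a) - 1) * (CARD('b) - 1)\<close>
  from the joint types, and 2 from the number of shells and the header.\<close>

lemma exists_universal_code:
  assumes d: "d \<ge> 0"
  shows "\<exists>C :: ('a::finite, 'b::finite) block_code. universal_semifaithful_code n d C \<and>
    (\<forall>\<rho>\<in>distortion_measures. \<forall>xs\<in>blocks n.
       real (length (encode C (quantize C xs \<rho>))) * ln 2
       \<le> real (CARD('a) * (CARD('b) - 1) + 2) * ln (real n + 1)
         + (2 * ln 2 + ln CARD('b) + ln (2 + ln (CARD('a) * CARD('b))))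
         + ln (real (card (perm_class xs)) / real (max_covered n d \<rho> xs)))"
proof -
  let ?\<Omega> = "blocks n :: 'b list set"
  define N where "N = card (mset ` ?\<Omega>)"
  \<comment> \<open>All shells are listed, admissible or not, so that the codebook and its ranks do
    not depend on \<open>\<rho>\<close>.\<close>
  define F where "F = (\<lambda>(xs :: 'a list, ys :: 'b list). shell xs ys) ` (blocks n \<times> blocks n)"
  define Q where "Q = (\<lambda>ys :: 'b list. 1 / (real N * real (card (perm_class ys))))"
  \<comment> \<open>After this many draws \<open>S\<close> is missed with probability at most
    \<open>exp (-1) / card F\<close>, so the sum over \<open>F\<close> stays below 1.\<close>
  define m where "m = (\<lambda>S. nat \<lceil>(1 + ln (card F)) / sum Q S\<rceil>)"
  have ne: "?\<Omega> \<noteq> {}" by (auto simp: blocks_def intro: exI[of _ "replicate n undefined"])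
  have N_pos: "N > 0" unfolding N_def using ne by (simp add: card_gt_0_iff)
  have "(blocks n :: 'a list set) \<noteq> {}" by (auto simp: blocks_def intro: exI[of _ "replicate n undefined"])
  then have F: "finite F" "card F > 0" using ne by (auto simp: F_def card_gt_0_iff)
  have "card F \<le> card ((blocks n :: 'a list set) \<times> ?\<Omega>)"
    unfolding F_def by (rule card_image_le) simp
  also have "\<dots> = (CARD('a) * CARD('b)) ^ n"
    by (simp add: card_cartesian_product card_blocks power_mult_distrib)
  finally have "real (card F) \<le> real ((CARD('a) * CARD('b)) ^ n)" by (rule of_nat_mono)
  then have "ln (card F) \<le> ln (real ((CARD('a) * CARD('b)) ^ n))"
    using F by (subst ln_le_cancel_iff) auto
  then have lnF: "ln (card F) \<le> real n * ln (CARD('a) * CARD('b))"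
    by (simp add: ln_realpow)
  have lnF0: "ln (card F) \<ge> 0" using F by simp
  have Q_nonneg: "Q ys \<ge> 0" for ys by (simp add: Q_def)
  have Q_sum: "sum Q ?\<Omega> = 1"
  proof -
    have "sum Q ?\<Omega> = (\<Sum>t\<in>mset ` ?\<Omega>. \<Sum>ys\<in>{ys \<in> ?\<Omega>. mset ys = t}. Q ys)"
      by (rule sum.image_gen) simp
    also have "\<dots> = (\<Sum>t\<in>mset ` ?\<Omega>. 1 / real N)"
    proof (intro sum.cong refl)
      fix t assume "t \<in> mset ` ?\<Omega>"
      then obtain ys where ys: "ys \<in> ?\<Omega>" "t = mset ys" by auto
      have "{ys \<in> ?\<Omega>. mset ys = t} = perm_class ys"
        using perm_class_subset_blocks[OF ys(1)] ys(2) by (auto simp: perm_class_def)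
      moreover have "(\<Sum>vs\<in>perm_class ys. Q vs) = (\<Sum>vs\<in>perm_class ys. Q ys)"
        by (intro sum.cong refl) (simp add: Q_def perm_class_eq)
      ultimately show "(\<Sum>ys\<in>{ys \<in> ?\<Omega>. mset ys = t}. Q ys) = 1 / real N"
        using card_perm_class_pos[of ys] perm_class_refl[of ys] by (auto simp: Q_def)
    qed
    also have "\<dots> = 1" using N_pos by (simp flip: N_def)
    finally show ?thesis .
  qed
  have F_sub: "S \<subseteq> ?\<Omega>" if "S \<in> F" for S
    using that by (auto simp: F_def shell_def blocks_def)
  have Q_shell: "sum Q (shell xs ys) = real (card (shell xs ys)) / (real N * real (card (perm_class ys)))"
    and shell_pos: "card (shell xs ys) > 0"
    if "xs \<in> blocks n" "ys \<in> blocks n" for xs :: "'a list" and ys :: "'b list"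
  proof -
    have sub: "shell xs ys \<subseteq> perm_class ys" using that by (rule shell_subset)
    have "sum Q (shell xs ys) = (\<Sum>vs\<in>shell xs ys. Q ys)"
      using sub by (intro sum.cong refl) (auto simp: Q_def perm_class_eq)
    then show "sum Q (shell xs ys) = real (card (shell xs ys)) / (real N * real (card (perm_class ys)))"
      by (simp add: Q_def)
    have "ys \<in> shell xs ys" using that by (simp add: shell_def blocks_def)
    then show "card (shell xs ys) > 0" using finite_subset[OF sub] by (auto simp: card_gt_0_iff)
  qed
  have q: "0 < sum Q S \<and> sum Q S \<le> 1" if S: "S \<in> F" for S
  proof -
    obtain xs :: "'a list" and ys where "xs \<in> blocks n" "ys \<in> blocks n" "S = shell xs ys"
      using S by (auto simp: F_def)
    then have "0 < sum Q S" using Q_shell shell_pos N_pos card_perm_class_pos[of ys] by simp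
    moreover have "sum Q S \<le> sum Q ?\<Omega>" using F_sub[OF S] Q_nonneg by (intro sum_mono2) auto
    ultimately show ?thesis using Q_sum by simp
  qed
  have "(\<Sum>S\<in>F. (1 - sum Q S) ^ m S) \<le> (\<Sum>S\<in>F. exp (-1) / card F)"
  proof (intro sum_mono)
    fix S assume S: "S \<in> F"
    have "(1 - sum Q S) ^ m S \<le> exp (- sum Q S) ^ m S"
      using q[OF S] exp_ge_add_one_self[of "- sum Q S"] by (intro power_mono) auto
    also have "\<dots> = exp (- (real (m S) * sum Q S))"
      by (simp flip: exp_of_nat_mult)
    also have "\<dots> \<le> exp (- (1 + ln (card F)))"
    proof -
      have "(1 + ln (card F)) / sum Q S \<le> real (m S)"
        unfolding m_def by (rule real_nat_ceiling_ge)
      then show ?thesis using q[OF S] by (simp add: divide_le_eq)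
    qed
    also have "\<dots> = exp (-1) / card F"
      using F exp_diff[of "-1" "ln (card F)"] by auto
    finally show "(1 - sum Q S) ^ m S \<le> exp (-1) / card F" .
  qed
  also have "\<dots> = exp (-1)" using F by auto
  also have "\<dots> < (1 :: real)" by simp
  finally have "(\<Sum>S\<in>F. (1 - sum Q S) ^ m S) < 1" .
  from covering_rank[OF finite_blocks F(1) F_sub Q_nonneg Q_sum this] obtain B r where B: "B \<subseteq> ?\<Omega>" "inj_on r B" "\<And>y. y \<in> B \<Longrightarrow> r y < card ?\<Omega>"
    and hit: "\<And>S. S \<in> F \<Longrightarrow> \<exists>y\<in>B \<inter> S. r y < m S"
    by blast
  \<comment> \<open>This crude exponent is harmless: it enters the codeword length only through its
    logarithm.\<close>
  have "card ?\<Omega> \<le> 2 ^ (n * CARD('b))"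
  proof -
    have "CARD('b) ^ n \<le> (2 ^ CARD('b)) ^ n" by (intro power_mono less_imp_le less_exp) simp
    then show ?thesis by (simp add: card_blocks mult.commute flip: power_mult)
  qed
  then have "r y < 2 ^ (n * CARD('b))" if "y \<in> B" for y using B(3)[OF that] by linarith
  from prefix_code_of_rank[OF B(2) this] obtain f :: "'b list \<Rightarrow> bool list" where
    f: "inj_on f B" "prefix_free (f ` B)"
    "\<And>y. y \<in> B \<Longrightarrow> real (length (f y)) * ln 2 \<le> 2 * ln 2 + ln (real (n * CARD('b)) + 1) + ln (real (r y) + 1)"
    by blast
  \<comment> \<open>The least admissible rank is at most the rank of any admissible block at which
    the enumeration meets a shell.\<close>
  define best where "best = (\<lambda>(xs :: 'a list) \<rho>. ARG_MIN r y. y \<in> B \<and> block_distortion n \<rho> xs y \<le> d)"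
  define C :: "('a, 'b) block_code" where
    "C = \<lparr>codebook = B, codestrings = f ` B, quantize = best, encode = f, decode = inv_into B f\<rparr>"
  have best: "best xs \<rho> \<in> B \<and> block_distortion n \<rho> xs (best xs \<rho>) \<le> d \<and>
      ln (real (r (best xs \<rho>)) + 1) \<le> ln (2 + ln (card F)) + real (CARD('a) * (CARD('b) - 1)) * ln (real n + 1)
        + ln (real (card (perm_class xs)) / real (max_covered n d \<rho> xs))"
    if \<rho>: "\<rho> \<in> distortion_measures" and xs: "xs \<in> blocks n" for \<rho> :: "'a \<Rightarrow> 'b \<Rightarrow> real" and xs
  proof -
    obtain ys where ys: "ys \<in> blocks n" "block_distortion n \<rho> xs ys \<le> d"
      "max_covered n d \<rho> xs \<le> (n + 1) ^ ((CARD('a) - 1) * (CARD('b) - 1)) * card (shell ys xs)"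
      using exists_good_shell(2)[OF \<rho> xs d] by blast
    have M_pos: "max_covered n d \<rho> xs > 0" by (rule exists_good_shell(1)[OF \<rho> xs d])
    have S: "shell xs ys \<in> F" using xs ys by (auto simp: F_def)
    then obtain y where y: "y \<in> B" "y \<in> shell xs ys" "r y < m (shell xs ys)" using hit by blast
    have "block_distortion n \<rho> xs y = block_distortion n \<rho> xs ys"
      using y(2) xs ys(1) by (intro block_distortion_cong) (auto simp: shell_def blocks_def)
    then have y_ok: "y \<in> B \<and> block_distortion n \<rho> xs y \<le> d" using y ys by simp
    have sel: "best xs \<rho> \<in> B \<and> block_distortion n \<rho> xs (best xs \<rho>) \<le> d" "r (best xs \<rho>) \<le> r y"
      using arg_min_nat_lemma[of "\<lambda>y. y \<in> B \<and> block_distortion n \<rho> xs y \<le> d" y r] y_ok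
      unfolding best_def by blast+
    let ?q = "sum Q (shell xs ys)"
    have len: "length ys = length xs" using xs ys by (simp add: blocks_def)
    have "real (r (best xs \<rho>)) + 1 \<le> real (m (shell xs ys))" using sel(2) y(3) by linarith
    also have "\<dots> \<le> (1 + ln (card F)) / ?q + 1"
    proof -
      have "(1 + ln (card F)) / ?q \<ge> 0" using q[OF S] lnF0 by simp
      then show ?thesis unfolding m_def by linarith
    qed
    \<comment> \<open>Since \<open>?q \<le> 1\<close>, the 1 lost by rounding up is
      absorbed.\<close>
    also have "\<dots> \<le> (1 + ln (card F)) / ?q + 1 / ?q"
      using q[OF S] by simp
    also have "\<dots> = (2 + ln (card F)) * (1 / ?q)" by (simp add: add_divide_distrib)
    \<comment> \<open>Double counting turns the weight of the shell around \<open>xs\<close> into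
      the size of the shell around \<open>ys\<close>, which \<open>ys(3)\<close> compares with
      \<open>max_covered\<close>.\<close>
    also have "1 / ?q \<le> real ((n + 1) ^ (CARD('a) * (CARD('b) - 1))) * (real (card (perm_class xs)) / real (max_covered n d \<rho> xs))"
    proof -
      have "1 / ?q = real N * (real (card (perm_class ys)) / real (card (shell xs ys)))"
        using Q_shell[OF xs ys(1)] by simp
      also have "real (card (perm_class ys)) / real (card (shell xs ys)) = real (card (perm_class xs)) / real (card (shell ys xs))"
      proof -
        have eq: "real (card (perm_class xs)) * real (card (shell xs ys)) = real (card (perm_class ys)) * real (card (shell ys xs))"
          using shell_double_count[OF len] by (metis of_nat_mult)
        have "card (shell xs ys) > 0" using shell_pos[OF xs ys(1)] .
        moreover have "card (shell ys xs) > 0" using M_pos ys(3) by (metis gr0I mult_0_right not_le)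
        ultimately show ?thesis using eq by (simp add: frac_eq_eq mult.commute)
      qed
      also have "real N * (real (card (perm_class xs)) / real (card (shell ys xs)))
          \<le> real ((n + 1) ^ (CARD('b) - 1)) * (real (card (perm_class xs))
              * (real ((n + 1) ^ ((CARD('a) - 1) * (CARD('b) - 1))) / real (max_covered n d \<rho> xs)))"
      proof (intro mult_mono)
        show "real N \<le> real ((n + 1) ^ (CARD('b) - 1))"
          unfolding N_def using card_types_le by (rule of_nat_mono)
        have "real (max_covered n d \<rho> xs) \<le> real ((n + 1) ^ ((CARD('a) - 1) * (CARD('b) - 1))) * real (card (shell ys xs))"
          using ys(3) by (metis of_nat_mono of_nat_mult)
        moreover have "card (shell ys xs) > 0" using M_pos ys(3) by (metis gr0I mult_0_right not_le)
        ultimately have "1 / real (card (shell ys xs)) \<le> real ((n + 1) ^ ((CARD('a) - 1) * (CARD('b) - 1))) / real (max_covered n d \<rho> xs)"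
          using M_pos by (simp add: divide_simps mult.commute)
        from mult_left_mono[OF this, of "real (card (perm_class xs))"]
        show "real (card (perm_class xs)) / real (card (shell ys xs))
            \<le> real (card (perm_class xs)) * (real ((n + 1) ^ ((CARD('a) - 1) * (CARD('b) - 1))) / real (max_covered n d \<rho> xs))"
          by simp
      qed auto
      also have "\<dots> = real ((n + 1) ^ (CARD('b) - 1 + (CARD('a) - 1) * (CARD('b) - 1))) * (real (card (perm_class xs)) / real (max_covered n d \<rho> xs))"
        unfolding power_add of_nat_mult by simp
      also have "CARD('b) - 1 + (CARD('a) - 1) * (CARD('b) - 1) = CARD('a) * (CARD('b) - 1)"
        by (metis One_nat_def Suc_pred mult_Suc zero_less_card_finite)
      finally show ?thesis .
    qed
    finally have "real (r (best xs \<rho>)) + 1 \<le> (2 + ln (card F)) *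
        (real ((n + 1) ^ (CARD('a) * (CARD('b) - 1))) * (real (card (perm_class xs)) / real (max_covered n d \<rho> xs)))"
      using lnF0 by (simp add: mult_left_mono)
    then have "ln (real (r (best xs \<rho>)) + 1) \<le> ln ((2 + ln (card F)) *
        (real ((n + 1) ^ (CARD('a) * (CARD('b) - 1))) * (real (card (perm_class xs)) / real (max_covered n d \<rho> xs))))"
      by (intro ln_mono) auto
    also have "\<dots> = ln (2 + ln (card F)) + (ln (real ((n + 1) ^ (CARD('a) * (CARD('b) - 1))))
        + ln (real (card (perm_class xs)) / real (max_covered n d \<rho> xs)))"
    proof -
      have "real (card (perm_class xs)) / real (max_covered n d \<rho> xs) > 0"
        using M_pos card_perm_class_pos[of xs] by simp
      moreover have "real ((n + 1) ^ (CARD('a) * (CARD('b) - 1))) > 0" by simp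
      moreover have "2 + ln (card F) > 0" using lnF0 by linarith
      ultimately show ?thesis using ln_mult_pos mult_pos_pos by metis
    qed
    also have "ln (real ((n + 1) ^ (CARD('a) * (CARD('b) - 1)))) = real (CARD('a) * (CARD('b) - 1)) * ln (real n + 1)"
      by (simp add: ln_realpow add.commute)
    finally show ?thesis using sel(1) by simp
  qed
  have "1 \<le> CARD('a) * CARD('b)" by (simp add: Suc_le_eq)
  then have "1 \<le> real (CARD('a) * CARD('b))" by linarith
  then have lnJK: "0 \<le> ln (CARD('a) * CARD('b))" by (rule ln_ge_zero)
  \<comment> \<open>The number of shells is exponential in \<open>n\<close>, so its logarithm costs
    only one factor linear in \<open>n\<close>; \<open>real n + 1\<close> also covers
    \<open>n = 0\<close>.\<close>
  have "ln (2 + ln (card F)) \<le> ln ((real n + 1) * (2 + ln (CARD('a) * CARD('b))))"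
  proof (intro ln_mono)
    show "2 + ln (card F) \<le> (real n + 1) * (2 + ln (CARD('a) * CARD('b)))"
      using lnF lnJK unfolding distrib_left distrib_right by linarith
  qed (use lnF0 in auto)
  also have "\<dots> = ln (real n + 1) + ln (2 + ln (CARD('a) * CARD('b)))"
    using lnJK by (intro ln_mult_pos) linarith+
  finally have cover_overhead: "ln (2 + ln (card F)) \<le> ln (real n + 1) + ln (2 + ln (CARD('a) * CARD('b)))" .
  have "ln (real (n * CARD('b)) + 1) \<le> ln ((real n + 1) * CARD('b))"
    by (intro ln_mono) (auto simp: algebra_simps intro: add_pos_nonneg)
  also have "\<dots> = ln (real n + 1) + ln CARD('b)"
    by (intro ln_mult_pos) auto
  finally have header_overhead: "ln (real (n * CARD('b)) + 1) \<le> ln (real n + 1) + ln CARD('b)" .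
  have "universal_semifaithful_code n d C"
    using B(1) best f(1,2) by (auto simp: universal_semifaithful_code_def C_def inv_into_f_f)
  moreover have "real (length (encode C (quantize C xs \<rho>))) * ln 2
       \<le> real (CARD('a) * (CARD('b) - 1) + 2) * ln (real n + 1)
         + (2 * ln 2 + ln CARD('b) + ln (2 + ln (CARD('a) * CARD('b))))
         + ln (real (card (perm_class xs)) / real (max_covered n d \<rho> xs))"
    if "\<rho> \<in> distortion_measures" "xs \<in> blocks n" for \<rho> :: "'a \<Rightarrow> 'b \<Rightarrow> real" and xs
  proof -
    have "real (length (encode C (quantize C xs \<rho>))) * ln 2
        \<le> 2 * ln 2 + ln (real (n * CARD('b)) + 1) + ln (real (r (best xs \<rho>)) + 1)"
      using f(3) best[OF that] by (simp add: C_def)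
    moreover have "real (CARD('a) * (CARD('b) - 1) + 2) * ln (real n + 1)
        = real (CARD('a) * (CARD('b) - 1)) * ln (real n + 1) + 2 * ln (real n + 1)"
      by (simp only: of_nat_add distrib_right of_nat_numeral)
    ultimately show ?thesis
      using best[OF that] cover_overhead header_overhead by linarith
  qed
  ultimately show ?thesis by blast
qed

section \<open>Redundancy and its limit\<close>

text \<open>The mean of the logarithmic term bounds the entropy of every quantizer from below, so it
  cancels and only the overhead \<open>c\<close> remains.\<close>

lemma rate_redundancy_le:
  fixes C :: "('a::finite, 'b::finite) block_code"
  assumes d: "d \<ge> 0" and \<rho>: "\<rho> \<in> distortion_measures"
    and len: "\<And>xs. xs \<in> blocks n \<Longrightarrow> real (length (encode C (quantize C xs \<rho>))) * ln 2
       \<le> c + ln (real (card (perm_class xs)) / real (max_covered n d \<rho> xs))"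
  shows "rate_redundancy n d C p \<rho> \<le> c / real n"
proof -
  let ?v = "replicate_pmf n p"
  let ?L = "\<lambda>xs. ln (real (card (perm_class xs)) / real (max_covered n d \<rho> xs))"
  have fin: "finite (set_pmf ?v)"
    using set_replicate_pmf_blocks finite_blocks by (rule finite_subset)
  note integrable = integrable_measure_pmf_finite[OF fin]
  have "measure_pmf.expectation ?v (\<lambda>xs. real (length (encode C (quantize C xs \<rho>))) * ln 2)
      \<le> measure_pmf.expectation ?v (\<lambda>xs. c + ?L xs)"
    using len set_replicate_pmf_blocks
    by (intro integral_mono_AE integrable) (auto simp: AE_measure_pmf_iff)
  also have "\<dots> = c + measure_pmf.expectation ?v ?L"
    by (subst Bochner_Integration.integral_add) (auto intro: integrable)
  finally have E: "measure_pmf.expectation ?v (\<lambda>xs. real (length (encode C (quantize C xs \<rho>))) * ln 2)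
      \<le> c + measure_pmf.expectation ?v ?L" .
  \<comment> \<open>A lower bound for all members passes to a real infimum only over a nonempty
    set.\<close>
  have ne: "d_quantizers n d \<rho> \<noteq> {}"
  proof -
    have "\<forall>xs\<in>blocks n. \<exists>ys. ys \<in> blocks n \<and> block_distortion n \<rho> xs ys \<le> d"
      using zero_distortion_block[OF \<rho>] d by metis
    then show ?thesis unfolding d_quantizers_def by (auto dest!: bchoice)
  qed
  have "measure_pmf.expectation ?v ?L / real n
      \<le> (INF \<phi> \<in> d_quantizers n d \<rho>. entropy_pmf (map_pmf \<phi> ?v) / real n)"
    using ne by (intro cINF_greatest divide_right_mono entropy_quantizer_ge) auto
  moreover have "(1 / real n) * measure_pmf.expectation ?v (\<lambda>xs. real (length (encode C (quantize C xs \<rho>))) * ln 2)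
      \<le> c / real n + measure_pmf.expectation ?v ?L / real n"
    using divide_right_mono[OF E, of "real n"] by (simp add: add_divide_distrib)
  ultimately show ?thesis unfolding rate_redundancy_def by linarith
qed

theorem theorem2:
  fixes \<rho>max d :: real
  assumes "\<rho>max > 0" and "d > 0"
  shows "\<exists>C :: nat \<Rightarrow> ('a::finite, 'b::finite) block_code.
           (\<forall>n\<ge>1. universal_semifaithful_code n d (C n)) \<and>
           limsup (\<lambda>n. SUP (p, \<rho>) \<in> UNIV \<times> bounded_distortion_measures \<rho>max.
                         ereal (rate_redundancy n d (C n) p \<rho> / (ln (real n) / real n)))
             \<le> ereal (real (CARD('a) * CARD('b) + CARD('a)))"
proof -
  define a where "a = real (CARD('a) * (CARD('b) - 1) + 2)"
  define c where "c = 2 * ln 2 + ln CARD('b) + ln (2 + ln (CARD('a) * CARD('b)))"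
  define bound where "bound = (\<lambda>n. (a * ln (real n + 1) + c) / ln (real n))"
  have "\<forall>n\<ge>1. \<exists>C :: ('a, 'b) block_code. universal_semifaithful_code n d C \<and>
    (\<forall>\<rho>\<in>distortion_measures. \<forall>xs\<in>blocks n.
       real (length (encode C (quantize C xs \<rho>))) * ln 2
       \<le> a * ln (real n + 1) + c + ln (real (card (perm_class xs)) / real (max_covered n d \<rho> xs)))"
    unfolding a_def c_def
    using exists_universal_code[where 'a = 'a and 'b = 'b, OF less_imp_le[OF assms(2)]] by blast
  then obtain C :: "nat \<Rightarrow> ('a, 'b) block_code" where
    C: "\<And>n. n \<ge> 1 \<Longrightarrow> universal_semifaithful_code n d (C n)"
    and len: "\<And>n \<rho> xs. n \<ge> 1 \<Longrightarrow> \<rho> \<in> distortion_measures \<Longrightarrow> xs \<in> blocks n \<Longrightarrow>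
       real (length (encode (C n) (quantize (C n) xs \<rho>))) * ln 2
       \<le> a * ln (real n + 1) + c + ln (real (card (perm_class xs)) / real (max_covered n d \<rho> xs))"
    by metis
  \<comment> \<open>From \<open>n = 2\<close> on, \<open>ln (real n)\<close> is positive and the
    division keeps the inequality.\<close>
  have ratio: "rate_redundancy n d (C n) p \<rho> / (ln (real n) / real n) \<le> bound n"
    if n: "n \<ge> 2" and \<rho>: "\<rho> \<in> bounded_distortion_measures \<rho>max" for n p \<rho>
  proof -
    have "rate_redundancy n d (C n) p \<rho> \<le> (a * ln (real n + 1) + c) / real n"
      using n \<rho> assms len by (intro rate_redundancy_le) (auto simp: bounded_distortion_measures_def)
    then have "rate_redundancy n d (C n) p \<rho> / (ln (real n) / real n)
        \<le> (a * ln (real n + 1) + c) / real n / (ln (real n) / real n)"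
      using n by (intro divide_right_mono) auto
    then show ?thesis using n by (simp add: bound_def)
  qed
  have "limsup (\<lambda>n. SUP (p, \<rho>) \<in> UNIV \<times> bounded_distortion_measures \<rho>max.
            ereal (rate_redundancy n d (C n) p \<rho> / (ln (real n) / real n)))
      \<le> limsup (\<lambda>n. ereal (bound n))"
  proof (intro Limsup_mono eventually_sequentiallyI)
    fix n :: nat assume "n \<ge> 2"
    then show "(SUP (p, \<rho>) \<in> UNIV \<times> bounded_distortion_measures \<rho>max.
            ereal (rate_redundancy n d (C n) p \<rho> / (ln (real n) / real n))) \<le> ereal (bound n)"
      using ratio by (intro SUP_least) auto
  qed
  also have "limsup (\<lambda>n. ereal (bound n)) = ereal a"
  proof (intro lim_imp_Limsup tendsto_ereal)
    show "bound \<longlonglongrightarrow> a" unfolding bound_def by real_asymp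
  qed simp
  \<comment> \<open>The claim amounts to \<open>2 \<le> 2 * CARD('a)\<close>; writing the sizes as
    successors removes the truncated subtraction in \<open>a\<close>.\<close>
  also have "ereal a \<le> ereal (real (CARD('a) * CARD('b) + CARD('a)))"
  proof -
    obtain J K where JK: "CARD('a) = Suc J" "CARD('b) = Suc K"
      by (metis not0_implies_Suc zero_less_card_finite less_irrefl)
    then show ?thesis by (simp add: a_def)
  qed
  finally show ?thesis using C by blast
qed

end
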